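(* Let $s_1,\dots,s_l$ be positive integers and $z\in\mathbb{C}$ with $|z|<1$. Then $$\mathop{\rm Li}\nolimits_{s_1,\dots,s_l}\!\left(\frac{-z}{1-z}\right)=(-1)^l\,\mu\big(z,\langle1\rangle_{s_l-1},\,z,\langle1\rangle_{s_{l-1}-1},\,\dots,\,z,\langle1\rangle_{s_1-1}\big),$$ where the argument list of $\mu$ consists of the blocks $z,\langle1\rangle_{s_j-1}$ for $j=l,l-1,\dots,1$ in this order.
   Context: For positive integers $s_1,\dots,s_l$, $\mathop{\rm Li}\nolimits_{s_1,\dots,s_l}(z)=\sum_{n_1>n_2>\dots>n_l\ge1}\frac{z^{n_1}}{n_1^{s_1}\cdots n_l^{s_l}}$ for $|z|<1$, analytically continued to $D=\mathbb{C}\setminus[1,+\infty)$. For complex numbers $a_1,\dots,a_m$, $$\mu(a_1,\dots,a_m)=\sum_{k_1=1}^\infty\cdots\sum_{k_m=1}^\infty\frac{a_1^{k_1}\cdots a_m^{k_m}}{(k_1+k_2+\dots+k_m)(k_2+\dots+k_m)\cdots(k_{m-1}+k_m)k_m}.$$ $\langle a\rangle_k$ denotes a list of $k$ entries all equal to $a$ (empty if $k=0$). *)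

theory Defs
  imports "HOL-Complex_Analysis.Complex_Analysis"
begin

definition decr_indices :: "nat \<Rightarrow> nat list set" where
  "decr_indices l = {ns. length ns = l \<and> sorted_wrt (>) ns \<and> (\<forall>n\<in>set ns. n \<ge> 1)}"

(* For a nonempty list ss of positive integers the family is absolutely summable when
   norm z < 1, so the unordered sum is the usual multiple series. *)
definition Li_series :: "nat list \<Rightarrow> complex \<Rightarrow> complex" where
  "Li_series ss z =
     (\<Sum>\<^sub>\<infinity>ns\<in>decr_indices (length ss). z ^ hd ns / (\<Prod>i<length ss. of_nat (ns ! i) ^ (ss ! i)))"

definition cut_plane :: "complex set" where
  "cut_plane = - (complex_of_real ` {1..})"

(* The cut plane is open and connected, so the values on it of a function chosen here
   are determined by the series on the unit disc. Values on the cut are unspecified. *)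
definition Li :: "nat list \<Rightarrow> complex \<Rightarrow> complex" where
  "Li ss = (SOME f. f holomorphic_on cut_plane \<and> (\<forall>z\<in>ball 0 1. f z = Li_series ss z))"

(* Iterated series over k_1, ..., k_m \<ge> 1 with k_1 outermost; the index tuple is passed to f
   as the list [k_1, ..., k_m]. *)
primrec iter_suminf :: "nat \<Rightarrow> (nat list \<Rightarrow> complex) \<Rightarrow> complex" where
  "iter_suminf 0 f = f []"
| "iter_suminf (Suc m) f = (\<Sum>k. iter_suminf m (\<lambda>ks. f (Suc k # ks)))"

(* Every one of the nested series converges. *)
primrec iter_summable :: "nat \<Rightarrow> (nat list \<Rightarrow> complex) \<Rightarrow> bool" where
  "iter_summable 0 f \<longleftrightarrow> True"
| "iter_summable (Suc m) f \<longleftrightarrow>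
     (\<forall>k. iter_summable m (\<lambda>ks. f (Suc k # ks))) \<and>
     summable (\<lambda>k. iter_suminf m (\<lambda>ks. f (Suc k # ks)))"

(* With 0-based i, the sum of drop i ks is k_{i+1} + ... + k_m. *)
definition mu_term :: "complex list \<Rightarrow> nat list \<Rightarrow> complex" where
  "mu_term as ks = (\<Prod>i<length as. (as ! i) ^ (ks ! i) / of_nat (sum_list (drop i ks)))"

definition mu :: "complex list \<Rightarrow> complex" where
  "mu as = iter_suminf (length as) (mu_term as)"

definition mu_converges :: "complex list \<Rightarrow> bool" where
  "mu_converges as \<longleftrightarrow> iter_summable (length as) (mu_term as)"

definition mu_args :: "complex \<Rightarrow> nat list \<Rightarrow> complex list" where
  "mu_args z ss = concat (map (\<lambda>s. z # replicate (s - 1) 1) (rev ss))"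

end

theory Submission imports Defs begin

text \<open>With the summation over \<open>k_m\<close> outermost, \<open>mu\<close> is obtained from the constant function \<open>1\<close> by applying
  \<open>f \<mapsto> (\<lambda>n. \<Sum>k\<ge>1. a ^ k / (n + k) * f (n + k))\<close> for each argument \<open>a\<close> in turn and evaluating
  at \<open>0\<close>. On connected sums \<open>\<lambda>n. \<Sum>m. c m * connector n m\<close>, where \<open>connector n m = n! m! / (n + m)!\<close>,
  the operator for \<open>a = 1\<close> divides \<open>c m\<close> by \<open>m\<close>, and the operator for \<open>a = z\<close> turns \<open>c m\<close> into
  \<open>- (\<Sum>i<m. c i * w ^ (m - i)) / m\<close> with \<open>w = - z / (1 - z)\<close>, provided \<open>norm w < 1\<close>. These are,
  up to sign, the recursions for the coefficients of \<open>Li\<close> at \<open>w\<close>, and all connectors are \<open>1\<close> at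
  \<open>n = 0\<close>. This gives the identity for small \<open>z\<close>; both sides are holomorphic in the unit disc.\<close>

(* Infinite_Set_Sum takes this infix over for integrability on count_space. *)
no_notation Infinite_Set_Sum.abs_summable_on (infix \<open>abs'_summable'_on\<close> 50)

text \<open>Tonelli's criterion with a majorant: an upper bound \<open>h\<close> for the inner sums
  of norms suffices, so they need not be evaluated.\<close>

lemma abs_summable_on_SigmaI:
  fixes f :: "'a \<times> 'b \<Rightarrow> 'c::real_normed_vector"
  assumes "\<And>x. x \<in> A \<Longrightarrow> (\<lambda>y. norm (f (x, y))) summable_on B x"
    and "\<And>x. x \<in> A \<Longrightarrow> (\<Sum>\<^sub>\<infinity>y\<in>B x. norm (f (x, y))) \<le> h x"
    and "h summable_on A"
  shows "f abs_summable_on Sigma A B"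
proof (rule summable_on_SigmaI)
  show "((\<lambda>y. norm (f (x, y))) has_sum (\<Sum>\<^sub>\<infinity>y\<in>B x. norm (f (x, y)))) (B x)" if "x \<in> A" for x
    using assms(1)[OF that] by simp
  show "(\<lambda>x. \<Sum>\<^sub>\<infinity>y\<in>B x. norm (f (x, y))) summable_on A"
    using assms(3) by (rule summable_on_comparison_test) (use assms(2) in \<open>auto intro: infsum_nonneg\<close>)
qed auto

subsection \<open>Connectors and the beta kernel\<close>

text \<open>The reciprocal of the binomial coefficient \<open>(n + m) choose n\<close>.\<close>

definition connector :: "nat \<Rightarrow> nat \<Rightarrow> real" where
  "connector n m = fact n * fact m / fact (n + m)"

lemma connector_0_left [simp]: "connector 0 n = 1"
  and connector_0_right [simp]: "connector n 0 = 1"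
  by (simp_all add: connector_def)

lemma connector_pos: "connector n m > 0"
  by (simp add: connector_def)

lemma connector_le_1: "connector n m \<le> 1"
proof -
  have "fact n * fact m \<le> (fact (n + m) :: nat)"
    by (intro dvd_imp_le fact_fact_dvd_fact) auto
  then have "real (fact n * fact m) \<le> real (fact (n + m))"
    by (rule of_nat_mono)
  then show ?thesis by (simp add: connector_def)
qed

text \<open>The Beta value \<open>B(n + 1, m + 1)\<close>, that is, the integral of
  \<open>t ^ n * (1 - t) ^ m\<close> over \<open>[0, 1]\<close>.\<close>

definition beta_kernel :: "nat \<Rightarrow> nat \<Rightarrow> real" where
  "beta_kernel n m = fact n * fact m / fact (Suc (n + m))"

text \<open>Reading the kernel in two ways is what moves summation from one side of a connected sum
  to the other: it is a connector with either \<open>n\<close> or \<open>m\<close> raised by one,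
  divided by the raised index.\<close>

lemma beta_kernel_eq_left: "beta_kernel n m = connector (Suc n) m / real (Suc n)"
  and beta_kernel_eq_right: "beta_kernel n m = connector n (Suc m) / real (Suc m)"
  by (simp_all add: beta_kernel_def connector_def divide_simps)

lemma beta_kernel_eq: "beta_kernel n m = connector n m / real (Suc (n + m))"
  by (simp add: beta_kernel_def connector_def divide_simps)

lemma beta_kernel_nonneg: "beta_kernel n m \<ge> 0"
  by (simp add: beta_kernel_def)

lemma beta_kernel_le_1: "beta_kernel n m \<le> 1"
proof -
  have "beta_kernel n m \<le> connector n m"
    using connector_pos[of n m] by (simp add: beta_kernel_eq divide_simps mult_le_cancel_left1)
  with connector_le_1 show ?thesis by (rule order_trans[rotated])
qed

text \<open>Under the Beta integral this is \<open>t + (1 - t) = 1\<close>; in factorials,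
  \<open>(n + 1) + (m + 1) = n + m + 2\<close>.\<close>

lemma beta_kernel_Suc: "beta_kernel (Suc n) m + beta_kernel n (Suc m) = beta_kernel n m"
proof -
  have "fact n * fact m * (real (Suc n) + real (Suc m)) / fact (Suc (Suc (n + m))) 
      = fact n * fact m / fact (Suc (n + m))"
    by (simp add: fact_Suc[of "Suc (n+m)"] divide_simps del: fact_Suc) 
  then show ?thesis
    by (simp add: beta_kernel_def add_divide_distrib[symmetric] algebra_simps)
qed

text \<open>There is equality at \<open>m = 0\<close>, and the connector decreases in its second
  argument. The bound forces decay in \<open>n\<close> when the second argument is positive.\<close>

lemma connector_Suc_le: "connector n (Suc m) \<le> 1 / real (Suc n)"
proof (induction m)
    case 0
    show ?case by (simp add: connector_def divide_simps)
  next
    case (Suc m)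
    have "connector n (Suc (Suc m)) = real (Suc (Suc m)) / real (Suc (Suc (n + m))) * connector n (Suc m)"
      by (simp add: connector_def divide_simps)
    also have "\<dots> \<le> 1 * connector n (Suc m)"
      using connector_pos[of n "Suc m"] by (intro mult_right_mono) auto
    finally show ?case using Suc by simp
  qed

text \<open>The series telescopes: \<open>beta_kernel (n + k) m\<close> is \<open>1 / m\<close>
  times the difference of \<open>connector (n + k) m\<close> and
  \<open>connector (n + k + 1) m\<close>, and these connectors tend to \<open>0\<close> because
  \<open>m > 0\<close>.\<close>

lemma has_sum_beta_kernel:
  assumes "m > 0"
  shows "((\<lambda>k. beta_kernel (n + k) m) has_sum (connector n m / real m)) UNIV"
proof (rule sums_nonneg_imp_has_sum)
  obtain m' where m: "m = Suc m'" using assms gr0_implies_Suc by blast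
  have "(\<lambda>k. connector (n + k) m) \<longlonglongrightarrow> 0"
  proof (rule tendsto_sandwich)
    show "\<forall>\<^sub>F k in sequentially. 0 \<le> connector (n + k) m"
      by (intro always_eventually allI less_imp_le connector_pos)
    show "\<forall>\<^sub>F k in sequentially. connector (n + k) m \<le> 1 / real (Suc (n + k))"
      unfolding m by (rule always_eventually, rule allI, rule connector_Suc_le)
    show "(\<lambda>k. 1 / real (Suc (n + k))) \<longlonglongrightarrow> 0"
      using LIMSEQ_ignore_initial_segment[OF lim_1_over_n, of "Suc n"] by (simp add: add.commute)
  qed simp
  then have "(\<lambda>k. connector (n + k) m / m) \<longlonglongrightarrow> 0"
    using tendsto_divide[OF _ tendsto_const[of "real m"]] assms by fastforce
  from telescope_sums'[OF this]
  have "(\<lambda>k. connector (n + k) m / m - connector (n + Suc k) m / m) sums (connector n m / m)"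
    by simp
  moreover have "connector (n + k) m / m - connector (n + Suc k) m / m = beta_kernel (n + k) m" for k
  proof -
    have "fact (n+k) * fact m / fact (n+k+m) - fact (Suc (n+k)) * fact m / fact (Suc (n+k+m))
       = real m * (fact (n+k) * fact m / fact (Suc (n+k+m)))"
      by (simp add: divide_simps) (simp add: algebra_simps)
    then show ?thesis using assms 
      by (simp add: connector_def beta_kernel_def divide_simps algebra_simps del: fact_Suc)
  qed
  ultimately show "(\<lambda>k. beta_kernel (n + k) m) sums (connector n m / real m)" by simp
qed (rule beta_kernel_nonneg)

section \<open>Splitting off the first term, and geometrically weighted sums\<close>

lemma summable_on_UNIV_nat_Suc:
  fixes f :: "nat \<Rightarrow> 'a::real_normed_vector"
  assumes "f summable_on UNIV"
  shows "(\<lambda>k. f (Suc k)) summable_on UNIV"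
proof -
  have "range Suc = UNIV - {0}"
    using not0_implies_Suc by auto
  then have "f summable_on range Suc"
    using summable_on_cofin_subset[OF assms, of "{0}"] by simp
  then show ?thesis
    by (simp add: summable_on_reindex o_def)
qed

lemma infsum_UNIV_nat_Suc:
  fixes f :: "nat \<Rightarrow> 'a::real_normed_vector"
  assumes "f summable_on UNIV"
  shows "infsum f UNIV = f 0 + (\<Sum>\<^sub>\<infinity>k. f (Suc k))"
proof -
  have "f sums infsum f UNIV"
    using assms by (intro has_sum_imp_sums has_sum_infsum)
  moreover have "(\<lambda>k. f (Suc k)) sums (\<Sum>\<^sub>\<infinity>k. f (Suc k))"
    using summable_on_UNIV_nat_Suc[OF assms] by (intro has_sum_imp_sums has_sum_infsum)
  ultimately show ?thesis
    by (metis add.commute sums_Suc sums_unique2)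
qed

lemma abs_summable_on_geometric:
  fixes z :: complex and g :: "nat \<Rightarrow> complex"
  assumes "norm z < 1" and "\<And>k. norm (g k) \<le> B"
  shows "(\<lambda>k. z ^ k * g k) abs_summable_on UNIV"
proof (rule Infinite_Sum.abs_summable_on_comparison_test')
  have "summable (\<lambda>k. norm z ^ k * B)"
    using assms(1) by (intro summable_mult2 summable_geometric) simp
  then show "(\<lambda>k. norm z ^ k * B) summable_on UNIV"
    by (rule summable_nonneg_imp_summable_on)
       (use order_trans[OF norm_ge_zero assms(2)] in simp)
  show "norm (z ^ k * g k) \<le> norm z ^ k * B" for k
    by (auto simp: norm_mult norm_power intro: mult_left_mono assms)
qed

lemma norm_infsum_geometric_le:
  fixes z :: complex and g :: "nat \<Rightarrow> complex"
  assumes "norm z < 1" and "\<And>k. norm (g k) \<le> B"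
  shows "norm (\<Sum>\<^sub>\<infinity>k. z ^ k * g k) \<le> B / (1 - norm z)"
proof (rule norm_infsum_le)
  show "((\<lambda>k. z ^ k * g k) has_sum (\<Sum>\<^sub>\<infinity>k. z ^ k * g k)) UNIV"
    using abs_summable_summable[OF abs_summable_on_geometric[OF assms]] by simp
  have "B \<ge> 0" using order_trans[OF norm_ge_zero assms(2)] .
  moreover have "(\<lambda>k. norm z ^ k * B) sums (1 / (1 - norm z) * B)"
    using assms(1) by (intro sums_mult2 geometric_sums) simp
  ultimately show "((\<lambda>k. norm z ^ k * B) has_sum (B / (1 - norm z))) UNIV"
    by (intro sums_nonneg_imp_has_sum) auto
  show "norm (z ^ k * g k) \<le> norm z ^ k * B" for k
    by (auto simp: norm_mult norm_power intro: mult_left_mono assms)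
qed

text \<open>As functions of \<open>n\<close>, both sides are bounded solutions of
  \<open>X n = z * beta_kernel n m + z * X (Suc n)\<close>, which has only one because \<open>norm z < 1\<close>.\<close>

lemma infsum_beta_kernel_transport:
  fixes z w :: complex
  assumes z: "norm z < 1" and w: "norm w < 1" and zw: "w = - z / (1 - z)"
  shows "(\<Sum>\<^sub>\<infinity>k. z ^ Suc k * of_real (beta_kernel (n + k) m))
       = - (\<Sum>\<^sub>\<infinity>j. w ^ Suc j * of_real (beta_kernel n (m + j)))"
proof -
  define X where "X n = (\<Sum>\<^sub>\<infinity>k. z ^ k * (z * of_real (beta_kernel (n + k) m)))" for n
  define Y where "Y n = (\<Sum>\<^sub>\<infinity>j. w ^ j * (- w * of_real (beta_kernel n (m + j))))" for n
  have z1: "z \<noteq> 1" using z by auto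
  have bX: "norm (z * of_real (beta_kernel a b)) \<le> norm z" 
    and bY: "norm (- w * of_real (beta_kernel a b)) \<le> norm w" for a b
    using beta_kernel_nonneg[of a b] beta_kernel_le_1[of a b]
    by (auto simp: norm_mult intro!: mult_left_le)
  have sX: "(\<lambda>k. z ^ k * (z * of_real (beta_kernel (n + k) m))) summable_on UNIV" for n
    by (rule abs_summable_summable[OF abs_summable_on_geometric[OF z bX]])
  have sY: "(\<lambda>j. w ^ j * (- w * of_real (beta_kernel n (m + j)))) summable_on UNIV" for n
    by (rule abs_summable_summable[OF abs_summable_on_geometric[OF w bY]])
  have recX: "X n = z * of_real (beta_kernel n m) + z * X (Suc n)" for n
    unfolding X_def
    by (subst infsum_UNIV_nat_Suc[OF sX]) (simp add: mult.assoc infsum_cmult_right')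
  have recY: "Y n = z * of_real (beta_kernel n m) + z * Y (Suc n)" for n
  proof -
    \<comment> \<open>Chosen so that the \<open>j\<close>-th term of \<open>Y n\<close> minus
      \<open>z\<close> times the \<open>j\<close>-th term of \<open>Y (Suc n)\<close> is
      \<open>h j - h (Suc j)\<close>; the sum over \<open>j\<close> then leaves only
      \<open>h 0\<close>.\<close>
    define h where "h j = z * w ^ j * of_real (beta_kernel n (m + j))" for j
    have "(\<lambda>j. w ^ j * (z * of_real (beta_kernel n (m + j)))) summable_on UNIV"
      by (rule abs_summable_summable[OF abs_summable_on_geometric[OF w, where B = "norm z"]])
         (use beta_kernel_nonneg beta_kernel_le_1 in \<open>auto simp: norm_mult intro!: mult_left_le\<close>)
    then have sh: "h summable_on UNIV" by (simp add: h_def[abs_def] mult_ac)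
    have sh': "(\<lambda>j. h (Suc j)) summable_on UNIV"
      using sh by (rule summable_on_UNIV_nat_Suc)
    have eq: "w ^ j * (- w * of_real (beta_kernel n (m + j)))
        = z * (w ^ j * (- w * of_real (beta_kernel (Suc n) (m + j)))) + (h j - h (Suc j))" for j
    proof -
      \<comment> \<open>The only place where the relation between \<open>w\<close> and
        \<open>z\<close> enters; rearranged it reads \<open>z - z * w = - w\<close>.\<close>
      have wz: "- w * (1 - z) = z" using z1 by (simp add: zw)
      have "beta_kernel n (m + Suc j) = beta_kernel n (m + j) - beta_kernel (Suc n) (m + j)"
        using beta_kernel_Suc[of n "m + j"] by simp
      then have "h (Suc j) = z * w * w ^ j * (of_real (beta_kernel n (m + j)) - of_real (beta_kernel (Suc n) (m + j)))"
        by (simp add: h_def)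
      then have "z * (w ^ j * (- w * of_real (beta_kernel (Suc n) (m + j)))) + (h j - h (Suc j)) =
         w ^ j * ((z - z * w) * of_real (beta_kernel n (m + j)))"
        by (simp add: h_def algebra_simps)
      also have "z - z * w = - w" using wz by (simp add: algebra_simps)
      finally show ?thesis by simp
    qed
    have "Y n = (\<Sum>\<^sub>\<infinity>j. z * (w ^ j * (- w * of_real (beta_kernel (Suc n) (m + j)))) + (h j - h (Suc j)))"
      unfolding Y_def eq ..
    also have "\<dots> = z * Y (Suc n) + (infsum h UNIV - (\<Sum>\<^sub>\<infinity>j. h (Suc j)))"
    proof (rule infsumI)
      have "((\<lambda>j. h j + - h (Suc j)) has_sum (infsum h UNIV + - (\<Sum>\<^sub>\<infinity>j. h (Suc j)))) UNIV"
        by (intro has_sum_add has_sum_uminusI has_sum_infsum sh sh')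
      then show "((\<lambda>j. z * (w ^ j * (- w * of_real (beta_kernel (Suc n) (m + j)))) + (h j - h (Suc j)))
          has_sum (z * Y (Suc n) + (infsum h UNIV - (\<Sum>\<^sub>\<infinity>j. h (Suc j))))) UNIV"
        unfolding Y_def by (intro has_sum_add has_sum_cmult_right has_sum_infsum sY) simp
    qed
    also have "infsum h UNIV - (\<Sum>\<^sub>\<infinity>j. h (Suc j)) = h 0"
      using infsum_UNIV_nat_Suc[OF sh] by simp
    finally show ?thesis by (simp add: h_def)
  qed
  define B where "B = norm z / (1 - norm z) + norm w / (1 - norm w)"
  have bound: "norm (X n - Y n) \<le> B" for n
    unfolding X_def Y_def B_def
    by (intro order_trans[OF norm_triangle_ineq4] add_mono
        norm_infsum_geometric_le[OF z bX] norm_infsum_geometric_le[OF w bY])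
  \<comment> \<open>The inhomogeneous terms cancel in the difference, so each step only costs a
    factor \<open>z\<close>, while \<open>B\<close> does not depend on \<open>n\<close>.\<close>
  have iter: "X n - Y n = z ^ k * (X (n + k) - Y (n + k))" for k
  proof (induction k)
    case (Suc k)
    have "X (n + k) - Y (n + k) = z * (X (Suc (n + k)) - Y (Suc (n + k)))"
      by (subst recX[of "n + k"], subst recY[of "n + k"]) (simp add: algebra_simps)
    then show ?case by (subst Suc.IH) (simp add: mult_ac)
  qed simp
  have "(\<lambda>k. norm z ^ k * B) \<longlonglongrightarrow> 0 * B"
    using z by (intro tendsto_mult LIMSEQ_power_zero tendsto_const) simp
  moreover have "norm (X n - Y n) \<le> norm z ^ k * B" for k
    by (subst iter[of k]) (auto simp: norm_mult norm_power intro!: mult_left_mono bound)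
  ultimately have "norm (X n - Y n) \<le> 0 * B"
    by (intro LIMSEQ_le_const) auto
  then show ?thesis
    unfolding X_def Y_def by (simp add: mult_ac infsum_uminus eq_neg_iff_add_eq_0)
qed

subsection \<open>Transport of connected sums\<close>

definition tail_sum :: "complex \<Rightarrow> (nat \<Rightarrow> complex) \<Rightarrow> nat \<Rightarrow> complex" where
  "tail_sum a f n = (\<Sum>\<^sub>\<infinity>k. a ^ Suc k / of_nat (Suc (n + k)) * f (Suc (n + k)))"

definition connected_sum :: "(nat \<Rightarrow> complex) \<Rightarrow> nat \<Rightarrow> complex" where
  "connected_sum c n = (\<Sum>\<^sub>\<infinity>m. c m * of_real (connector n m))"

text \<open>The denominator \<open>n + k + 1\<close> is absorbed into the connector by
  \<open>beta_kernel_eq_left\<close>. Constant factors pass through \<open>infsum\<close> whether or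
  not the family is summable.\<close>

lemma tail_sum_connected_sum:
  "tail_sum a (connected_sum c) n
     = (\<Sum>\<^sub>\<infinity>k. \<Sum>\<^sub>\<infinity>m. c m * (a ^ Suc k * of_real (beta_kernel (n + k) m)))"
proof -
  have "a ^ Suc k / of_nat (Suc (n + k)) * connected_sum c (Suc (n + k))
      = (\<Sum>\<^sub>\<infinity>m. c m * (a ^ Suc k * of_real (beta_kernel (n + k) m)))" for k
    unfolding connected_sum_def beta_kernel_eq_left infsum_cmult_right'[symmetric]
    by (intro infsum_cong) (simp del: of_nat_Suc)
  then show ?thesis by (simp add: tail_sum_def)
qed

text \<open>After exchanging the sums, the inner sum over \<open>k\<close> is the telescoping one of
  \<open>has_sum_beta_kernel\<close>. The condition \<open>c 0 = 0\<close> removes the row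
  \<open>m = 0\<close>, whose kernel gives a harmonic series.\<close>

lemma tail_sum_connected_sum_one:
  assumes c: "c abs_summable_on UNIV" and c0: "c 0 = 0"
  shows "tail_sum 1 (connected_sum c) n = connected_sum (\<lambda>m. c m / of_nat m) n"
proof -
  have inner: "((\<lambda>k. norm (c m * of_real (beta_kernel (n + k) m)))
      has_sum (norm (c m) * (connector n m / m))) UNIV" for m
  proof (cases "m = 0")
    case False
    then have "((\<lambda>k. norm (c m) * beta_kernel (n + k) m) has_sum (norm (c m) * (connector n m / m))) UNIV"
      by (intro has_sum_cmult_right has_sum_beta_kernel) simp
    then show ?thesis
      using beta_kernel_nonneg by (simp add: norm_mult)
  qed (simp add: c0)
  have le: "norm (c m) * (connector n m / m) \<le> norm (c m)" for m
  proof (cases "m = 0")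
    case False
    have "connector n m \<le> 1 * real m"
      using connector_le_1[of n m] False by linarith
    with False show ?thesis
      by (intro mult_left_le) (auto simp: divide_simps)
  qed simp
  have "(\<lambda>(m, k). c m * of_real (beta_kernel (n + k) m)) abs_summable_on UNIV \<times> UNIV"
    by (rule abs_summable_on_SigmaI[OF _ _ c])
       (simp_all only: prod.case infsumI[OF inner] has_sum_imp_summable[OF inner] le)
  then have "(\<lambda>(m, k). c m * of_real (beta_kernel (n + k) m)) summable_on UNIV \<times> UNIV"
    by (rule abs_summable_summable)
  then have "tail_sum 1 (connected_sum c) n = (\<Sum>\<^sub>\<infinity>m. \<Sum>\<^sub>\<infinity>k. c m * of_real (beta_kernel (n + k) m))"
    by (subst infsum_swap_banach) (simp_all add: tail_sum_connected_sum)
  also have "\<dots> = (\<Sum>\<^sub>\<infinity>m. c m / of_nat m * of_real (connector n m))"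
  proof (intro infsum_cong)
    fix m :: nat
    show "(\<Sum>\<^sub>\<infinity>k. c m * of_real (beta_kernel (n + k) m)) = c m / of_nat m * of_real (connector n m)"
    proof (cases "m = 0")
      case False
      then have "((\<lambda>k. c m * of_real (beta_kernel (n + k) m)) has_sum (c m * of_real (connector n m / m))) UNIV"
        by (intro has_sum_cmult_right has_sum_of_real has_sum_beta_kernel) simp
      then show ?thesis by (simp add: infsumI)
    qed (simp add: c0)
  qed
  finally show ?thesis by (simp add: connected_sum_def)
qed

text \<open>For fixed \<open>m\<close>, \<open>infsum_beta_kernel_transport\<close> trades the sum
  over the left index in powers of \<open>z\<close> for one over the right index in powers of
  \<open>w\<close>. Reading the kernel from the right and collecting terms with the same connector
  gives the new coefficients.\<close>

lemma tail_sum_connected_sum_Landen: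
  fixes z w :: complex
  assumes c: "c abs_summable_on UNIV"
    and z: "norm z < 1" and w: "norm w < 1" and zw: "w = - z / (1 - z)"
  shows "tail_sum z (connected_sum c) n
           = connected_sum (\<lambda>m. - (\<Sum>i<m. c i * w ^ (m - i)) / of_nat m) n"
proof -
  have bound: "norm (of_real (beta_kernel a b) :: complex) \<le> 1" for a b
    using beta_kernel_nonneg[of a b] beta_kernel_le_1[of a b] by simp
  \<comment> \<open>Stated for a general \<open>v\<close> because the double sums before and after
    the transport need it with \<open>v = z\<close> and \<open>v = w\<close>.\<close>
  have norm_sums: "(\<lambda>k. norm (c m * (v ^ Suc k * g k))) summable_on UNIV"
      "(\<Sum>\<^sub>\<infinity>k. norm (c m * (v ^ Suc k * g k))) \<le> norm (c m) * (1 / (1 - norm v))"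
    if v: "norm v < 1" and g: "\<And>k. norm (g k) \<le> 1" for m and v :: complex and g :: "nat \<Rightarrow> complex"
  proof -
    have "(\<lambda>k. norm v ^ k) sums (1 / (1 - norm v))"
      using v by (intro geometric_sums) simp
    then have geo: "((\<lambda>k. norm (c m) * norm v ^ k) has_sum (norm (c m) * (1 / (1 - norm v)))) UNIV"
      by (intro has_sum_cmult_right sums_nonneg_imp_has_sum) auto
    have le: "norm (c m * (v ^ Suc k * g k)) \<le> norm (c m) * norm v ^ k" for k
    proof -
      have "norm v * norm (g k) \<le> 1 * 1"
        using v g by (intro mult_mono) auto
      then have "norm v ^ k * (norm v * norm (g k)) \<le> norm v ^ k * 1"
        by (intro mult_left_mono) auto
      then have "norm (c m) * (norm v ^ k * (norm v * norm (g k))) \<le> norm (c m) * (norm v ^ k * 1)"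
        by (rule mult_left_mono) simp
      then show ?thesis by (simp add: norm_mult norm_power mult_ac)
    qed
    show *: "(\<lambda>k. norm (c m * (v ^ Suc k * g k))) summable_on UNIV"
      by (rule summable_on_comparison_test[OF has_sum_imp_summable[OF geo] le]) simp
    show "(\<Sum>\<^sub>\<infinity>k. norm (c m * (v ^ Suc k * g k))) \<le> norm (c m) * (1 / (1 - norm v))"
      by (rule has_sum_mono[OF has_sum_infsum[OF *] geo le])
  qed
  have summable: "(\<lambda>(m, k). c m * (v ^ Suc k * g m k)) summable_on UNIV \<times> UNIV"
    if v: "norm v < 1" and g: "\<And>m k. norm (g m k) \<le> 1" for v :: complex and g :: "nat \<Rightarrow> nat \<Rightarrow> complex"
    by (rule abs_summable_summable, rule abs_summable_on_SigmaI[OF _ _ summable_on_cmult_left[OF c, of "1 / (1 - norm v)"]])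
       (simp_all only: prod.case norm_sums[OF v g])
  have "tail_sum z (connected_sum c) n
      = (\<Sum>\<^sub>\<infinity>m. \<Sum>\<^sub>\<infinity>k. c m * (z ^ Suc k * of_real (beta_kernel (n + k) m)))"
    by (subst infsum_swap_banach[OF summable[OF z bound]]) (rule tail_sum_connected_sum)
  also have "\<dots> = (\<Sum>\<^sub>\<infinity>m. - (\<Sum>\<^sub>\<infinity>j. c m * (w ^ Suc j * of_real (beta_kernel n (m + j)))))"
    by (simp only: infsum_cmult_right' infsum_beta_kernel_transport[OF z w zw] mult_minus_right)
  also have "\<dots> = - (\<Sum>\<^sub>\<infinity>(m, j)\<in>UNIV \<times> UNIV. c m * (w ^ Suc j * of_real (beta_kernel n (m + j))))"
    by (simp only: infsum_uminus infsum_Sigma'_banach[OF summable[OF w bound]])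
  \<comment> \<open>Substitute \<open>b = m + j + 1\<close> and \<open>i = m\<close>: the kernel
    becomes \<open>connector n b / b\<close> and the exponent \<open>j + 1\<close> becomes
    \<open>b - i\<close>.\<close>
  also have "(\<Sum>\<^sub>\<infinity>(m, j)\<in>UNIV \<times> UNIV. c m * (w ^ Suc j * of_real (beta_kernel n (m + j))))
      = (\<Sum>\<^sub>\<infinity>(b, i)\<in>(SIGMA b:UNIV. {..<b}). c i * w ^ (b - i) / of_nat b * of_real (connector n b))"
    by (rule infsum_reindex_bij_witness[of _ "\<lambda>(b, i). (i, b - i - 1)" "\<lambda>(m, j). (Suc (m + j), m)"])
       (auto simp: beta_kernel_eq_right simp del: of_nat_Suc power_Suc)
  also have "\<dots> = (\<Sum>\<^sub>\<infinity>b. \<Sum>i<b. c i * w ^ (b - i) / of_nat b * of_real (connector n b))"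
  proof (subst infsum_Sigma'_banach[symmetric])
    show "(\<lambda>(b, i). c i * w ^ (b - i) / of_nat b * of_real (connector n b))
        summable_on (SIGMA b:UNIV. {..<b})"
      by (rule summable_on_reindex_bij_witness[THEN iffD1, OF _ _ _ _ _ summable[OF w bound],
            of "\<lambda>(b, i). (i, b - i - 1)" "\<lambda>(m, j). (Suc (m + j), m)" _ _ "\<lambda>m j. n" "\<lambda>m j. m + j"])
         (auto simp: beta_kernel_eq_right simp del: of_nat_Suc power_Suc)
  qed simp
  finally show ?thesis
    unfolding connected_sum_def infsum_uminus[symmetric]
    by (simp add: sum_distrib_right sum_divide_distrib)
qed

text \<open>The coefficient of the \<open>n\<close>-th power in the polylogarithm series, where
  \<open>n\<close> is the largest summation index. The index \<open>m = 0\<close> contributes only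
  for \<open>ss = []\<close>, where it produces the numerator \<open>1\<close> of
  \<open>1 / n ^ s\<close>.\<close>

primrec mpl_coeff :: "nat list \<Rightarrow> nat \<Rightarrow> real" where
  "mpl_coeff [] n = (if n = 0 then 1 else 0)"
| "mpl_coeff (s # ss) n = (\<Sum>m<n. mpl_coeff ss m) / real n ^ s"

lemma mpl_coeff_nonneg: "mpl_coeff ss n \<ge> 0"
  by (induction ss arbitrary: n) (auto intro!: divide_nonneg_nonneg sum_nonneg)

text \<open>For \<open>n > 0\<close> the numerator has \<open>n\<close> terms, each at most
  \<open>1\<close>, and \<open>n ^ s\<close> is at least \<open>n\<close>.\<close>

lemma mpl_coeff_le_1:
  assumes "\<forall>s\<in>set ss. s \<ge> 1"
  shows "mpl_coeff ss n \<le> 1"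
  using assms
proof (induction ss arbitrary: n)
  case (Cons s ss)
  show ?case
  proof (cases "n = 0")
    case False
    have "(\<Sum>m<n. mpl_coeff ss m) \<le> (\<Sum>m<n. 1)"
      using Cons by (intro sum_mono) auto
    also have "\<dots> \<le> real n ^ s"
      using False Cons.prems self_le_power[of "real n" s] by simp
    finally show ?thesis
      using False by (simp add: divide_simps)
  qed simp
qed simp

lemma abs_summable_mpl_coeff:
  fixes w :: complex
  assumes "\<forall>s\<in>set ss. s \<ge> 1" and "norm w < 1"
  shows "(\<lambda>m. w ^ m * of_real (mpl_coeff ss m)) abs_summable_on UNIV"
  by (rule abs_summable_on_geometric[OF assms(2), where B = 1])
     (use mpl_coeff_nonneg mpl_coeff_le_1[OF assms(1)] in simp)

text \<open>The starting point of the recursion: only \<open>m = 0\<close> survives, and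
  \<open>connector n 0 = 1\<close>.\<close>

lemma connected_sum_delta:
  "connected_sum (\<lambda>m. w ^ m * of_real (mpl_coeff [] m)) = (\<lambda>_. 1)"
proof
  fix n
  have "((\<lambda>m. w ^ m * of_real (mpl_coeff [] m) * of_real (connector n m)) has_sum 1) UNIV"
    by (rule has_sum_finite_neutralI[of "{0}"]) auto
  then show "connected_sum (\<lambda>m. w ^ m * of_real (mpl_coeff [] m)) n = 1"
    unfolding connected_sum_def by (rule infsumI)
qed

lemma abs_summable_divide_nat_power:
  fixes c :: "nat \<Rightarrow> complex"
  assumes "c abs_summable_on UNIV"
  shows "(\<lambda>m. c m / of_nat m ^ k) abs_summable_on UNIV"
proof (rule summable_on_comparison_test[OF assms])
  show "norm (c m / of_nat m ^ k) \<le> norm (c m)" for m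
  proof (cases "m = 0")
    case True
    then show ?thesis by (cases k) auto
  next
    case False
    then have "1 \<le> real m ^ k" by (intro one_le_power) simp
    then show ?thesis
      by (simp add: norm_divide norm_power divide_le_eq mult_le_cancel_left1)
  qed
qed simp

lemma fold_tail_sum_replicate_one:
  assumes "c abs_summable_on UNIV" and "c 0 = 0"
  shows "fold tail_sum (replicate k 1) (connected_sum c) = connected_sum (\<lambda>m. c m / of_nat m ^ k)"
proof (induction k)
  case (Suc k)
  \<comment> \<open>\<open>fold\<close> applies the head of the list first, so the additional
    operator is taken from the end of the list.\<close>
  have "fold tail_sum (replicate (Suc k) 1) (connected_sum c)
      = tail_sum 1 (fold tail_sum (replicate k 1) (connected_sum c))"
    by (simp add: replicate_append_same[symmetric] del: replicate_Suc)
  also have "\<dots> = connected_sum (\<lambda>m. c m / of_nat m ^ k / of_nat m)"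
    unfolding Suc using assms
    by (intro ext tail_sum_connected_sum_one abs_summable_divide_nat_power) auto
  finally show ?case by (simp add: mult.commute)
qed simp

text \<open>\<open>mu_args\<close> reverses \<open>ss\<close>, so the block of the head
  \<open>s\<close> is applied last, to the connected sum for \<open>ss\<close>. Its \<open>z\<close>
  prepends the exponent \<open>1\<close> and contributes one sign; its \<open>s - 1\<close> ones
  raise that exponent to \<open>s\<close>.\<close>

lemma fold_tail_sum_mu_args:
  fixes z w :: complex
  assumes "\<forall>s\<in>set ss. s \<ge> 1"
    and z: "norm z < 1" and w: "norm w < 1" and zw: "w = - z / (1 - z)"
  shows "fold tail_sum (mu_args z ss) (\<lambda>_. 1)
           = connected_sum (\<lambda>m. (-1) ^ length ss * (w ^ m * of_real (mpl_coeff ss m)))"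
  using assms(1)
proof (induction ss)
  case Nil
  show ?case using connected_sum_delta[of w] by (simp add: mu_args_def)
next
  case (Cons s ss)
  define c where "c m = (-1) ^ length ss * (w ^ m * of_real (mpl_coeff ss m))" for m
  define d where "d m = - (\<Sum>i<m. c i * w ^ (m - i)) / of_nat m" for m
  have c: "c abs_summable_on UNIV"
    using abs_summable_mpl_coeff[of ss w] Cons.prems w by (simp add: c_def norm_mult norm_power)
  \<comment> \<open>The powers of \<open>w\<close> in \<open>c i * w ^ (m - i)\<close> combine to
    \<open>w ^ m\<close>, so the convolution reduces to the partial sum defining
    \<open>mpl_coeff (1 # ss)\<close>.\<close>
  have d_eq: "d m = (-1) ^ length (s # ss) * (w ^ m * of_real (mpl_coeff (1 # ss) m))" for m
  proof -
    have "(\<Sum>i<m. c i * w ^ (m - i)) = (\<Sum>i<m. (-1) ^ length ss * w ^ m * of_real (mpl_coeff ss i))"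
    proof (rule sum.cong)
      fix i assume "i \<in> {..<m}"
      then have "w ^ i * w ^ (m - i) = w ^ m"
        by (simp flip: power_add)
      then show "c i * w ^ (m - i) = (-1) ^ length ss * w ^ m * of_real (mpl_coeff ss i)"
        by (simp add: c_def mult_ac)
    qed simp
    then show ?thesis
      by (simp add: d_def sum_distrib_left[symmetric])
  qed
  have "norm (d m) = norm (w ^ m * of_real (mpl_coeff (1 # ss) m))" for m
    unfolding d_eq by (simp add: norm_mult norm_power del: mpl_coeff.simps)
  then have d: "d abs_summable_on UNIV" "d 0 = 0"
    using abs_summable_mpl_coeff[of "1 # ss" w] Cons.prems w by (simp_all add: d_def)
  have "fold tail_sum (mu_args z (s # ss)) (\<lambda>_. 1)
      = fold tail_sum (replicate (s - 1) 1) (tail_sum z (fold tail_sum (mu_args z ss) (\<lambda>_. 1)))"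
    by (simp add: mu_args_def)
  also have "fold tail_sum (mu_args z ss) (\<lambda>_. 1) = connected_sum c"
    using Cons by (simp add: c_def[abs_def])
  also have "tail_sum z (connected_sum c) = connected_sum d"
    unfolding d_def by (intro ext tail_sum_connected_sum_Landen c z w zw)
  also have "fold tail_sum (replicate (s - 1) 1) (connected_sum d) = connected_sum (\<lambda>m. d m / of_nat m ^ (s - 1))"
    using d by (rule fold_tail_sum_replicate_one)
  also have "(\<lambda>m. d m / of_nat m ^ (s - 1))
      = (\<lambda>m. (-1) ^ length (s # ss) * (w ^ m * of_real (mpl_coeff (s # ss) m)))"
  proof
    fix m
    have "of_nat m * of_nat m ^ (s - 1) = (of_nat m :: complex) ^ s"
      using Cons.prems by (cases s) auto
    then show "d m / of_nat m ^ (s - 1) = (-1) ^ length (s # ss) * (w ^ m * of_real (mpl_coeff (s # ss) m))"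
      by (simp add: d_eq)
  qed
  finally show ?case .
qed

subsection \<open>The multiple series as an iterated tail sum\<close>

definition pos_tuples :: "nat \<Rightarrow> nat list set" where
  "pos_tuples m = {ks. length ks = m \<and> (\<forall>k\<in>set ks. k \<ge> 1)}"

lemma pos_tuples_0 [simp]: "pos_tuples 0 = {[]}"
  by (auto simp: pos_tuples_def)

lemma bij_betw_Cons_pos_tuples:
  "bij_betw (\<lambda>(k, ks). Suc k # ks) (UNIV \<times> pos_tuples m) (pos_tuples (Suc m))"
  by (rule bij_betwI[of _ _ _ "\<lambda>ks. (hd ks - 1, tl ks)"])
     (auto simp: pos_tuples_def length_Suc_conv)

text \<open>Splits off \<open>k_m\<close>, the outermost variable for \<open>tail_sum\<close>,
  whereas \<open>iter_suminf\<close> has \<open>k_1\<close> outermost.\<close>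

lemma bij_betw_snoc_pos_tuples:
  "bij_betw (\<lambda>(k, ks). ks @ [Suc k]) (UNIV \<times> pos_tuples m) (pos_tuples (Suc m))"
  by (rule bij_betwI[of _ _ _ "\<lambda>ks. (last ks - 1, butlast ks)"])
     (auto simp: pos_tuples_def length_Suc_conv_rev)

text \<open>Fubini, one variable at a time: sections of an absolutely summable family are absolutely
  summable, so every nested series converges. The unordered sum then makes the order of summation
  irrelevant.\<close>

lemma iter_suminf_eq_infsum:
  assumes "f abs_summable_on pos_tuples m"
  shows "iter_summable m f \<and> iter_suminf m f = infsum f (pos_tuples m)"
  using assms
proof (induction m arbitrary: f)
  case 0
  show ?case by simp
next
  case (Suc m)
  have abs: "(\<lambda>(k, ks). f (Suc k # ks)) abs_summable_on UNIV \<times> pos_tuples m"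
    using summable_on_reindex_bij_betw[OF bij_betw_Cons_pos_tuples, of "\<lambda>ks. norm (f ks)" m] Suc.prems
    by (simp add: case_prod_unfold)
  then have sum: "(\<lambda>(k, ks). f (Suc k # ks)) summable_on UNIV \<times> pos_tuples m"
    by (rule abs_summable_summable)
  have "(\<lambda>ks. f (Suc k # ks)) abs_summable_on pos_tuples m" for k
    using abs by (simp add: Infinite_Sum.abs_summable_on_Sigma_iff)
  then have IH: "iter_summable m (\<lambda>ks. f (Suc k # ks)) \<and>
      iter_suminf m (\<lambda>ks. f (Suc k # ks)) = (\<Sum>\<^sub>\<infinity>ks\<in>pos_tuples m. f (Suc k # ks))" for k
    by (rule Suc.IH)
  have sums: "(\<lambda>k. \<Sum>\<^sub>\<infinity>ks\<in>pos_tuples m. f (Suc k # ks)) sums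
      (\<Sum>\<^sub>\<infinity>k. \<Sum>\<^sub>\<infinity>ks\<in>pos_tuples m. f (Suc k # ks))"
    by (intro has_sum_imp_sums has_sum_infsum summable_on_Sigma_banach sum)
  also have "(\<Sum>\<^sub>\<infinity>k. \<Sum>\<^sub>\<infinity>ks\<in>pos_tuples m. f (Suc k # ks)) = infsum f (pos_tuples (Suc m))"
    unfolding infsum_Sigma'_banach[OF sum]
    using infsum_reindex_bij_betw[OF bij_betw_Cons_pos_tuples, of f m] by (simp add: case_prod_unfold)
  finally show ?case
    using IH by (simp add: sums_iff)
qed

text \<open>The shift \<open>n\<close> stands for the indices already split off at the end of the
  tuple, which occur in all remaining denominators.\<close>

definition shifted_mu_term :: "complex list \<Rightarrow> nat \<Rightarrow> nat list \<Rightarrow> complex" where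
  "shifted_mu_term as n ks = (\<Prod>i<length as. (as ! i) ^ (ks ! i) / of_nat (n + sum_list (drop i ks)))"

lemma shifted_mu_term_0: "shifted_mu_term as 0 = mu_term as"
  by (simp add: fun_eq_iff shifted_mu_term_def mu_term_def)

lemma shifted_mu_term_snoc:
  assumes "length ks = length as"
  shows "shifted_mu_term (as @ [a]) n (ks @ [k]) = a ^ k / of_nat (n + k) * shifted_mu_term as (n + k) ks"
proof -
  have "(\<Prod>i<length as. ((as @ [a]) ! i) ^ ((ks @ [k]) ! i) / of_nat (n + sum_list (drop i (ks @ [k]))))
      = shifted_mu_term as (n + k) ks"
    unfolding shifted_mu_term_def
  proof (rule prod.cong[OF refl])
    fix i assume "i \<in> {..<length as}"
    then have i: "i < length as" "i < length ks" using assms by simp_all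
    then have "n + sum_list (drop i (ks @ [k])) = n + k + sum_list (drop i ks)" by simp
    with i show "((as @ [a]) ! i) ^ ((ks @ [k]) ! i) / of_nat (n + sum_list (drop i (ks @ [k])))
        = (as ! i) ^ (ks ! i) / of_nat (n + k + sum_list (drop i ks))"
      by (simp only: nth_append if_True)
  qed
  then show ?thesis
    using assms by (simp add: shifted_mu_term_def nth_append)
qed

text \<open>One induction step for three claims that depend on each other: absolute summability, a
  bound for the sum of norms, and the value. \<open>h\<close> bounds the inner sums of norms, and
  \<open>H\<close> dominates the resulting outer series.\<close>

lemma shifted_mu_term_sums_snoc:
  fixes F :: "nat \<Rightarrow> complex" and h :: "nat \<Rightarrow> real"
  assumes abs: "\<And>n. shifted_mu_term as n abs_summable_on pos_tuples (length as)"
    and h: "\<And>n. (\<Sum>\<^sub>\<infinity>ks\<in>pos_tuples (length as). norm (shifted_mu_term as n ks)) \<le> h n"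
    and F: "\<And>n. (\<Sum>\<^sub>\<infinity>ks\<in>pos_tuples (length as). shifted_mu_term as n ks) = F n"
    and H: "\<And>k. norm a ^ Suc k / real (Suc (n + k)) * h (Suc (n + k)) \<le> H k" "(H has_sum S) UNIV"
  defines "as' \<equiv> as @ [a]"
  shows "shifted_mu_term as' n abs_summable_on pos_tuples (length as')"
    and "(\<Sum>\<^sub>\<infinity>ks\<in>pos_tuples (length as'). norm (shifted_mu_term as' n ks)) \<le> S"
    and "(\<Sum>\<^sub>\<infinity>ks\<in>pos_tuples (length as'). shifted_mu_term as' n ks) = tail_sum a F n"
proof -
  let ?P = "pos_tuples (length as)"
  define g where "g = (\<lambda>(k, ks). a ^ Suc k / of_nat (Suc (n + k)) * shifted_mu_term as (Suc (n + k)) ks)"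
  have g: "shifted_mu_term as' n (case p of (k, ks) \<Rightarrow> ks @ [Suc k]) = g p" if "p \<in> UNIV \<times> ?P" for p
    using that by (auto simp: g_def as'_def pos_tuples_def shifted_mu_term_snoc simp del: power_Suc)
  have len: "length as' = Suc (length as)" by (simp add: as'_def)
  have norm_g: "norm (g (k, ks))
      = norm a ^ Suc k / real (Suc (n + k)) * norm (shifted_mu_term as (Suc (n + k)) ks)" for k ks
    by (simp add: g_def norm_mult norm_divide norm_power del: of_nat_Suc power_Suc)
  have sec: "(\<lambda>ks. norm (g (k, ks))) summable_on ?P" for k
    unfolding norm_g by (intro summable_on_cmult_right abs)
  have sec_le: "(\<Sum>\<^sub>\<infinity>ks\<in>?P. norm (g (k, ks))) \<le> H k" for k
    unfolding norm_g infsum_cmult_right'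
    by (rule order_trans[OF mult_left_mono[OF h] H(1)]) simp
  have g_abs: "g abs_summable_on UNIV \<times> ?P"
    by (rule abs_summable_on_SigmaI[OF sec sec_le has_sum_imp_summable[OF H(2)]])
  have g_sum: "g summable_on UNIV \<times> ?P"
    using g_abs by (rule abs_summable_summable)
  have "(\<lambda>p. norm (shifted_mu_term as' n (case p of (k, ks) \<Rightarrow> ks @ [Suc k]))) summable_on UNIV \<times> ?P"
    using g_abs by (subst summable_on_cong[where g = "\<lambda>p. norm (g p)"]) (simp_all only: g)
  then show "shifted_mu_term as' n abs_summable_on pos_tuples (length as')"
    unfolding len
    by (subst (asm) summable_on_reindex_bij_betw[OF bij_betw_snoc_pos_tuples, of "\<lambda>ks. norm (shifted_mu_term as' n ks)"])
  have "(\<Sum>\<^sub>\<infinity>ks\<in>pos_tuples (length as'). norm (shifted_mu_term as' n ks)) = (\<Sum>\<^sub>\<infinity>p\<in>UNIV \<times> ?P. norm (g p))"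
    unfolding len
    by (subst infsum_reindex_bij_betw[OF bij_betw_snoc_pos_tuples, symmetric]) (intro infsum_cong arg_cong[of _ _ norm] g)
  also have "\<dots> = (\<Sum>\<^sub>\<infinity>k. \<Sum>\<^sub>\<infinity>ks\<in>?P. norm (g (k, ks)))"
    by (rule infsum_Sigma_banach[symmetric, OF g_abs])
  also have "\<dots> \<le> S"
  proof (rule has_sum_mono[OF has_sum_infsum H(2)])
    show "(\<lambda>k. \<Sum>\<^sub>\<infinity>ks\<in>?P. norm (g (k, ks))) summable_on UNIV"
      using summable_on_Sigma_banach[of "\<lambda>k ks. norm (g (k, ks))" UNIV "\<lambda>_. ?P"] g_abs
      by (simp add: case_prod_unfold)
  qed (rule sec_le)
  finally show "(\<Sum>\<^sub>\<infinity>ks\<in>pos_tuples (length as'). norm (shifted_mu_term as' n ks)) \<le> S" .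
  have "(\<Sum>\<^sub>\<infinity>ks\<in>pos_tuples (length as'). shifted_mu_term as' n ks) = infsum g (UNIV \<times> ?P)"
    unfolding len
    by (subst infsum_reindex_bij_betw[OF bij_betw_snoc_pos_tuples, symmetric]) (intro infsum_cong g)
  also have "\<dots> = (\<Sum>\<^sub>\<infinity>k. \<Sum>\<^sub>\<infinity>ks\<in>?P. g (k, ks))"
    by (rule infsum_Sigma_banach[symmetric, OF g_sum])
  also have "\<dots> = tail_sum a F n"
    by (simp only: g_def prod.case tail_sum_def infsum_cmult_right' F)
  finally show "(\<Sum>\<^sub>\<infinity>ks\<in>pos_tuples (length as'). shifted_mu_term as' n ks) = tail_sum a F n" .
qed

text \<open>The case \<open>m = 1\<close> of \<open>has_sum_beta_kernel\<close>.\<close>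

lemma has_sum_telescoping: "((\<lambda>k. 1 / (real (Suc (n + k)) * real (Suc (Suc (n + k))))) has_sum (1 / real (Suc n))) UNIV"
proof -
  have "beta_kernel (n + k) 1 = 1 / (real (Suc (n + k)) * real (Suc (Suc (n + k))))" for k
    by (simp add: beta_kernel_def)
  moreover have "connector n 1 = 1 / real (Suc n)"
    by (simp add: connector_def)
  ultimately show ?thesis
    using has_sum_beta_kernel[of 1 n] by simp
qed

text \<open>The first argument gives a geometric series and the bound \<open>K / (n + 1)\<close>.
  This form of bound reproduces itself: for a further argument of norm at most \<open>1\<close>, the
  terms \<open>K / ((n + k + 1) * (n + k + 2))\<close> again sum to \<open>K / (n + 1)\<close>.
  Induction from the right keeps \<open>z\<close> in first place.\<close>

lemma shifted_mu_term_sums: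
  assumes "norm z < 1" and "\<forall>b\<in>set bs. norm b \<le> 1"
  defines "K \<equiv> norm z / (1 - norm z)" and "as \<equiv> z # bs"
  shows "(\<forall>n. shifted_mu_term as n abs_summable_on pos_tuples (length as)) \<and>
         (\<forall>n. (\<Sum>\<^sub>\<infinity>ks\<in>pos_tuples (length as). norm (shifted_mu_term as n ks)) \<le> K / real (Suc n)) \<and>
         (\<forall>n. (\<Sum>\<^sub>\<infinity>ks\<in>pos_tuples (length as). shifted_mu_term as n ks) = fold tail_sum as (\<lambda>_. 1) n)"
  using assms(2) unfolding as_def
proof (induction bs rule: rev_induct)
  case Nil
  have H1: "norm z ^ Suc k / real (Suc (n + k)) * 1 \<le> norm z ^ Suc k / real (Suc n)" for n k
    using frac_le[of "norm z ^ Suc k" "norm z ^ Suc k" "real (Suc n)" "real (Suc (n + k))"] by simp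
  have H2: "((\<lambda>k. norm z ^ Suc k / real (Suc n)) has_sum (K / real (Suc n))) UNIV" for n
  proof -
    have "(\<lambda>k. norm z * norm z ^ k / real (Suc n)) sums (norm z * (1 / (1 - norm z)) / real (Suc n))"
      using assms(1) by (intro sums_divide sums_mult geometric_sums) simp
    then show ?thesis
      by (intro sums_nonneg_imp_has_sum) (auto simp: K_def)
  qed
  have "shifted_mu_term [] n abs_summable_on pos_tuples (length [])"
    "(\<Sum>\<^sub>\<infinity>ks\<in>pos_tuples (length []). norm (shifted_mu_term [] n ks)) \<le> 1"
    "(\<Sum>\<^sub>\<infinity>ks\<in>pos_tuples (length []). shifted_mu_term [] n ks) = 1" for n
    by (simp_all add: shifted_mu_term_def)
  from shifted_mu_term_sums_snoc[OF this H1 H2] show ?case by simp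
next
  case (snoc b bs)
  have K: "K \<ge> 0" using assms(1) by (simp add: K_def)
  have H1: "norm b ^ Suc k / real (Suc (n + k)) * (K / real (Suc (Suc (n + k))))
      \<le> K * (1 / (real (Suc (n + k)) * real (Suc (Suc (n + k)))))" for n k
  proof -
    have "norm b ^ Suc k \<le> 1" using snoc.prems by (intro power_le_one) auto
    then have "norm b ^ Suc k * (K / (real (Suc (n + k)) * real (Suc (Suc (n + k)))))
        \<le> 1 * (K / (real (Suc (n + k)) * real (Suc (Suc (n + k)))))"
      using K by (intro mult_right_mono divide_nonneg_nonneg) auto
    then show ?thesis by (simp add: mult_ac)
  qed
  have H2: "((\<lambda>k. K * (1 / (real (Suc (n + k)) * real (Suc (Suc (n + k)))))) has_sum (K / real (Suc n))) UNIV" for n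
    using has_sum_cmult_right[OF has_sum_telescoping[of n], of K] by simp
  have IH: "shifted_mu_term (z # bs) n abs_summable_on pos_tuples (length (z # bs))"
    "(\<Sum>\<^sub>\<infinity>ks\<in>pos_tuples (length (z # bs)). norm (shifted_mu_term (z # bs) n ks)) \<le> K / real (Suc n)"
    "(\<Sum>\<^sub>\<infinity>ks\<in>pos_tuples (length (z # bs)). shifted_mu_term (z # bs) n ks)
      = fold tail_sum (z # bs) (\<lambda>_. 1) n" for n
    using snoc by auto
  from shifted_mu_term_sums_snoc[OF IH H1 H2] show ?case by simp
qed

lemma mu_eq_fold_tail_sum:
  assumes "norm z < 1" and "\<forall>b\<in>set bs. norm b \<le> 1"
  shows "mu_converges (z # bs) \<and> mu (z # bs) = fold tail_sum (z # bs) (\<lambda>_. 1) 0"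
proof -
  have "mu_term (z # bs) abs_summable_on pos_tuples (length (z # bs))"
    using shifted_mu_term_sums[OF assms] unfolding shifted_mu_term_0[symmetric] by blast
  then have "mu_converges (z # bs) \<and> mu (z # bs) = infsum (mu_term (z # bs)) (pos_tuples (length (z # bs)))"
    unfolding mu_converges_def mu_def by (rule iter_suminf_eq_infsum)
  moreover have "infsum (mu_term (z # bs)) (pos_tuples (length (z # bs))) = fold tail_sum (z # bs) (\<lambda>_. 1) 0"
    using shifted_mu_term_sums[OF assms] unfolding shifted_mu_term_0[symmetric] by blast
  ultimately show ?thesis by simp
qed

text \<open>Supplies the majorants for locally uniform convergence in
  \<open>holomorphic_fold_tail_sum\<close>.\<close>

lemma norm_fold_tail_sum_le:
  assumes "norm z < 1" and "\<forall>b\<in>set bs. norm b \<le> 1"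
  shows "norm (fold tail_sum (z # bs) (\<lambda>_. 1) n) \<le> norm z / (1 - norm z) / real (Suc n)"
proof -
  have "norm (fold tail_sum (z # bs) (\<lambda>_. 1) n)
      \<le> (\<Sum>\<^sub>\<infinity>ks\<in>pos_tuples (length (z # bs)). norm (shifted_mu_term (z # bs) n ks))"
    using shifted_mu_term_sums[OF assms] norm_infsum_bound[of "shifted_mu_term (z # bs) n" "pos_tuples (length (z # bs))"]
    by metis
  also have "\<dots> \<le> norm z / (1 - norm z) / real (Suc n)"
    using shifted_mu_term_sums[OF assms] by blast
  finally show ?thesis .
qed

subsection \<open>Power series and continuation of the multiple polylogarithm\<close>

text \<open>The fibres over the largest index, which is the exponent of the variable in
  \<open>Li_series\<close>. The tuples have length \<open>l + 1\<close>, so \<open>hd\<close> is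
  meaningful.\<close>

definition indices_with_head :: "nat \<Rightarrow> nat \<Rightarrow> nat list set" where
  "indices_with_head l n = {ns \<in> decr_indices (Suc l). hd ns = n}"

definition index_weight :: "nat list \<Rightarrow> nat list \<Rightarrow> real" where
  "index_weight ss ns = 1 / (\<Prod>i<length ss. real (ns ! i) ^ (ss ! i))"

lemma index_weight_nonneg: "index_weight ss ns \<ge> 0"
  by (simp add: index_weight_def prod_nonneg)

lemma index_weight_Cons: "index_weight (s # ss) (n # ns) = index_weight ss ns / real n ^ s"
  by (simp add: index_weight_def prod.lessThan_Suc_shift del: prod.lessThan_Suc)

lemma indices_with_head_0: "indices_with_head 0 n = (if n = 0 then {} else {[n]})"
  by (auto simp: indices_with_head_def decr_indices_def length_Suc_conv)

lemma indices_with_head_Suc: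
  "indices_with_head (Suc l) n = (#) n ` (\<Union>m<n. indices_with_head l m)"
proof (rule set_eqI)
  fix ns
  show "ns \<in> indices_with_head (Suc l) n \<longleftrightarrow> ns \<in> (#) n ` (\<Union>m<n. indices_with_head l m)"
    by (cases ns; cases "tl ns") (auto simp: indices_with_head_def decr_indices_def image_iff)
qed

lemma finite_indices_with_head: "finite (indices_with_head l n)"
  by (induction l arbitrary: n) (auto simp: indices_with_head_0 indices_with_head_Suc)

text \<open>Splitting the tails according to their largest entry \<open>m < n\<close> reproduces the
  recursion of \<open>mpl_coeff\<close>.\<close>

lemma sum_index_weight:
  assumes "length ss = Suc l"
  shows "(\<Sum>ns\<in>indices_with_head l n. index_weight ss ns) = mpl_coeff ss n"
  using assms
proof (induction l arbitrary: ss n)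
  case 0
  then obtain s where "ss = [s]" by (auto simp: length_Suc_conv)
  then show ?case by (simp add: indices_with_head_0 index_weight_def)
next
  case (Suc l)
  then obtain s ss' where ss: "ss = s # ss'" "length ss' = Suc l" by (auto simp: length_Suc_conv)
  have "(\<Sum>ns\<in>indices_with_head (Suc l) n. index_weight ss ns)
      = (\<Sum>ns\<in>(\<Union>m<n. indices_with_head l m). index_weight ss' ns / real n ^ s)"
    unfolding indices_with_head_Suc ss(1) by (subst sum.reindex) (auto simp: index_weight_Cons)
  also have "\<dots> = (\<Sum>m<n. \<Sum>ns\<in>indices_with_head l m. index_weight ss' ns / real n ^ s)"
    by (rule sum.UNION_disjoint) (simp, simp add: finite_indices_with_head, auto simp: indices_with_head_def)
  also have "\<dots> = mpl_coeff ss n"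
    by (simp add: ss(1) Suc.IH[OF ss(2)] flip: sum_divide_distrib)
  finally show ?case .
qed

text \<open>Group the multiple series by its largest index. The fibres are finite and the weights
  nonnegative, so the sums of norms over the fibres are exactly the norms of the power series
  terms.\<close>

lemma Li_series_eq_power_series:
  assumes "ss \<noteq> []" and s1: "\<forall>s\<in>set ss. s \<ge> 1" and w: "norm w < 1"
  shows "Li_series ss w = (\<Sum>\<^sub>\<infinity>n. w ^ n * of_real (mpl_coeff ss n))"
proof -
  obtain l where l: "length ss = Suc l"
    using assms(1) by (cases ss) auto
  define g where "g = (\<lambda>(n, ns). w ^ n * of_real (index_weight ss ns))"
  let ?S = "SIGMA n:UNIV. indices_with_head l n"
  have "Li_series ss w = infsum g ?S"
    unfolding Li_series_def l
    by (rule infsum_reindex_bij_witness[of _ snd "\<lambda>ns. (hd ns, ns)"])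
       (auto simp: indices_with_head_def g_def index_weight_def l)
  also have "g abs_summable_on ?S"
  proof (rule abs_summable_on_SigmaI[OF _ _ abs_summable_mpl_coeff[OF s1 w]])
    fix n
    have "(\<Sum>ns\<in>indices_with_head l n. norm (g (n, ns))) = norm w ^ n * (\<Sum>ns\<in>indices_with_head l n. index_weight ss ns)"
      using index_weight_nonneg[of ss] by (simp add: g_def norm_mult norm_power sum_distrib_left)
    then show "(\<Sum>\<^sub>\<infinity>ns\<in>indices_with_head l n. norm (g (n, ns))) \<le> norm (w ^ n * of_real (mpl_coeff ss n))"
      using mpl_coeff_nonneg[of ss n]
      by (simp add: finite_indices_with_head sum_index_weight[OF l] norm_mult norm_power)
  qed (simp add: finite_indices_with_head)
  then have "infsum g ?S = (\<Sum>\<^sub>\<infinity>n. \<Sum>\<^sub>\<infinity>ns\<in>indices_with_head l n. g (n, ns))"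
    by (rule infsum_Sigma_banach[symmetric, OF abs_summable_summable])
  also have "\<dots> = (\<Sum>\<^sub>\<infinity>n. w ^ n * of_real (mpl_coeff ss n))"
    unfolding sum_index_weight[OF l, symmetric]
    by (simp add: finite_indices_with_head g_def sum_distrib_left)
  finally show ?thesis .
qed

lemma Li_series_sums:
  assumes "ss \<noteq> []" and "\<forall>s\<in>set ss. s \<ge> 1" and "norm w < 1"
  shows "(\<lambda>n. of_real (mpl_coeff ss n) * w ^ n) sums Li_series ss w"
  using has_sum_imp_sums[OF has_sum_infsum[OF abs_summable_summable[OF abs_summable_mpl_coeff[OF assms(2,3)]]]]
  by (simp add: Li_series_eq_power_series[OF assms] mult.commute)

section \<open>Geometry of the cut plane\<close>

lemma cut_plane_eq: "cut_plane = - {z. Im z = 0 \<and> Re z \<ge> 1}"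
proof -
  have "z \<in> complex_of_real ` {1..} \<longleftrightarrow> Im z = 0 \<and> Re z \<ge> 1" for z
    by (auto simp: complex_eq_iff image_iff)
  then show ?thesis by (auto simp: cut_plane_def)
qed

lemma open_cut_plane: "open cut_plane"
  unfolding cut_plane_eq by (intro open_Compl closed_Collect_conj closed_Collect_eq closed_Collect_le continuous_intros)

text \<open>The centre is \<open>0\<close>: scaling by a factor in \<open>[0, 1]\<close> cannot move
  a point onto the cut unless it was on the cut already. Starlikeness is what provides primitives
  below.\<close>

lemma starlike_cut_plane: "starlike cut_plane"
  unfolding starlike_def
proof (intro bexI[of _ 0] ballI subsetI)
  fix x y assume x: "x \<in> cut_plane" and "y \<in> closed_segment 0 x"
  then obtain u where u: "0 \<le> u" "u \<le> 1" and y: "y = of_real u * x"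
    by (auto simp: in_segment scaleR_conv_of_real)
  show "y \<in> cut_plane"
  proof (rule ccontr)
    assume "y \<notin> cut_plane"
    then have "u * Im x = 0" "u * Re x \<ge> 1" by (auto simp: cut_plane_eq y)
    moreover from this have "Re x > 0" "u > 0"
      using u(1) zero_less_mult_iff[of u "Re x"] by auto
    moreover from this have "u * Re x \<le> Re x"
      using u by (intro mult_left_le_one_le) auto
    ultimately have "Im x = 0 \<and> Re x \<ge> 1" by simp
    with x show False by (simp add: cut_plane_eq)
  qed
qed (simp add: cut_plane_eq)

lemma ball_subset_cut_plane: "ball 0 1 \<subseteq> cut_plane"
proof
  fix z :: complex assume "z \<in> ball 0 1"
  then have "Re z < 1" using complex_Re_le_cmod[of z] by simp
  then show "z \<in> cut_plane" by (simp add: cut_plane_eq)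
qed

definition continues_to_cut_plane :: "(nat \<Rightarrow> complex) \<Rightarrow> bool" where
  "continues_to_cut_plane c \<longleftrightarrow>
     (\<exists>f. f holomorphic_on cut_plane \<and> (\<forall>z\<in>ball 0 1. (\<lambda>n. c n * z ^ n) sums f z))"

text \<open>A differential recursion for the polylogarithms becomes a recursion for their coefficients:
  \<open>diffs\<close>, partial sums and shift correspond to \<open>f'\<close>, \<open>f z / (1 - z)\<close> and \<open>f z / z\<close>.\<close>

lemma continues_to_cut_plane_antideriv:
  assumes "continues_to_cut_plane (diffs c)"
    and summable: "\<And>z. norm z < 1 \<Longrightarrow> summable (\<lambda>n. c n * z ^ n)"
  shows "continues_to_cut_plane c"
proof -
  obtain q where q: "q holomorphic_on cut_plane" and q_sums: "\<And>z. norm z < 1 \<Longrightarrow> (\<lambda>n. diffs c n * z ^ n) sums q z"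
    using assms(1) by (auto simp: continues_to_cut_plane_def)
  obtain F where F: "\<And>z. z \<in> cut_plane \<Longrightarrow> (F has_field_derivative q z) (at z)"
    using holomorphic_starlike_primitive[OF holomorphic_on_imp_continuous_on[OF q] starlike_cut_plane open_cut_plane, of "{}"]
      q open_cut_plane by (metis Diff_empty finite.emptyI holomorphic_on_imp_differentiable_at)
  \<comment> \<open>Normalised so that the primitive agrees with the power series at
    \<open>0\<close>.\<close>
  define f where "f z = F z - F 0 + c 0" for z
  define g where "g z = (\<Sum>n. c n * z ^ n)" for z
  have f: "(f has_field_derivative q z) (at z)" if "z \<in> cut_plane" for z
    unfolding f_def using F[OF that] by (auto intro!: derivative_eq_intros)
  have g: "(g has_field_derivative q z) (at z)" if "norm z < 1" for z
  proof -
    have "(g has_field_derivative (\<Sum>n. diffs c n * z ^ n)) (at z)"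
      unfolding g_def by (rule termdiffs_strong'[OF summable that])
    then show ?thesis using sums_unique[OF q_sums[OF that]] by simp
  qed
  have "\<exists>k. \<forall>z\<in>ball 0 1. f z - g z = k"
  proof (rule has_field_derivative_zero_constant)
    fix z :: complex assume z: "z \<in> ball 0 1"
    then have "((\<lambda>z. f z - g z) has_field_derivative q z - q z) (at z)"
      using ball_subset_cut_plane by (intro DERIV_diff f g) auto
    then show "((\<lambda>z. f z - g z) has_field_derivative 0) (at z within ball 0 1)"
      by (simp add: has_field_derivative_at_within)
  qed simp
  moreover have "f 0 - g 0 = 0"
    by (simp add: f_def g_def)
  ultimately have "f z = g z" if "norm z < 1" for z
    using that by (metis centre_in_ball eq_iff_diff_eq_0 mem_ball_0 zero_less_one)
  moreover have "f holomorphic_on cut_plane"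
    using f by (meson field_differentiable_def field_differentiable_at_within holomorphic_on_def)
  ultimately show ?thesis
    using summable by (auto simp: continues_to_cut_plane_def g_def intro!: exI[of _ f] summable_sums)
qed

lemma continues_to_cut_plane_partial_sums:
  assumes "continues_to_cut_plane c"
    and abs: "\<And>z. norm z < 1 \<Longrightarrow> summable (\<lambda>n. norm (c n * z ^ n))"
  shows "continues_to_cut_plane (\<lambda>n. \<Sum>m\<le>n. c m)"
proof -
  obtain f where f: "f holomorphic_on cut_plane" and f_sums: "\<And>z. norm z < 1 \<Longrightarrow> (\<lambda>n. c n * z ^ n) sums f z"
    using assms(1) by (auto simp: continues_to_cut_plane_def)
  have "(\<lambda>z. f z / (1 - z)) holomorphic_on cut_plane"
    using f by (intro holomorphic_intros) (auto simp: cut_plane_eq)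
  moreover have "(\<lambda>n. (\<Sum>m\<le>n. c m) * z ^ n) sums (f z / (1 - z))" if z: "norm z < 1" for z
  proof -
    \<comment> \<open>Cauchy product with the geometric series.\<close>
    have "(\<lambda>n. \<Sum>m\<le>n. c m * z ^ m * z ^ (n - m)) sums ((\<Sum>n. c n * z ^ n) * (\<Sum>n. z ^ n))"
      using z by (intro Cauchy_product_sums abs) (simp_all add: norm_power summable_geometric)
    moreover have "(\<Sum>m\<le>n. c m * z ^ m * z ^ (n - m)) = (\<Sum>m\<le>n. c m) * z ^ n" for n
      unfolding sum_distrib_right
      by (intro sum.cong) (auto simp: mult.assoc simp flip: power_add)
    ultimately show ?thesis
      using sums_unique[OF f_sums[OF z]] suminf_geometric[OF z] by (simp add: mult.assoc)
  qed
  ultimately show ?thesis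
    by (auto simp: continues_to_cut_plane_def intro!: exI[of _ "\<lambda>z. f z / (1 - z)"])
qed

lemma continues_to_cut_plane_shift:
  assumes "continues_to_cut_plane c" and c0: "c 0 = 0"
  shows "continues_to_cut_plane (\<lambda>n. c (Suc n))"
proof -
  obtain f where f: "f holomorphic_on cut_plane" and f_sums: "\<And>z. norm z < 1 \<Longrightarrow> (\<lambda>n. c n * z ^ n) sums f z"
    using assms(1) by (auto simp: continues_to_cut_plane_def)
  \<comment> \<open>The singularity at \<open>0\<close> is removable because \<open>f 0 = 0\<close>;
    the filled-in value is the constant coefficient \<open>c 1\<close> of the shifted
    series.\<close>
  define q where "q z = (if z = 0 then deriv f 0 else f z / z)" for z
  have f0: "f 0 = 0"
    using sums_unique2[OF f_sums[of 0] powser_sums_zero] c0 by simp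
  have "deriv f 0 = c 1"
  proof (rule DERIV_imp_deriv)
    have "((\<lambda>z. \<Sum>n. c n * z ^ n) has_field_derivative (\<Sum>n. diffs c n * 0 ^ n)) (at 0)"
      by (rule termdiffs_strong'[of 1]) (auto intro: sums_summable[OF f_sums])
    then have "((\<lambda>z. \<Sum>n. c n * z ^ n) has_field_derivative c 1) (at 0)"
      by (simp add: powser_zero diffs_def)
    then show "(f has_field_derivative c 1) (at 0)"
      by (rule has_field_derivative_transform_within_open[of _ _ _ "ball 0 1"])
         (auto intro: sums_unique[symmetric] f_sums)
  qed
  then have "(\<lambda>n. c (Suc n) * z ^ n) sums q z" if "norm z < 1" for z
  proof (cases "z = 0")
    case True
    with \<open>deriv f 0 = c 1\<close> show ?thesis
      using powser_sums_zero[of "\<lambda>n. c (Suc n)"] by (simp add: q_def)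
  next
    case False
    have "(\<lambda>n. c (Suc n) * z ^ Suc n) sums f z"
      using f_sums[OF that] c0 by (subst sums_Suc_iff) simp
    from sums_divide[OF this, of z] False show ?thesis
      by (simp add: q_def)
  qed
  moreover have "q holomorphic_on cut_plane"
    by (rule pole_theorem_open_0[OF f open_cut_plane, of 0]) (auto simp: q_def f0)
  ultimately show ?thesis
    by (auto simp: continues_to_cut_plane_def intro!: exI[of _ q])
qed

section \<open>Continuation by recursion on the exponents\<close>

lemma summable_mpl_coeff:
  fixes z :: complex
  assumes "\<forall>s\<in>set ss. s \<ge> 1" and "norm z < 1"
  shows "summable (\<lambda>n. norm (of_real (mpl_coeff ss n) * z ^ n))"
  using summable_on_imp_summable[OF abs_summable_mpl_coeff[OF assms]] by (simp add: mult.commute)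

text \<open>Corresponds to the derivative of \<open>Li\<close> for \<open>s + 1, ...\<close> being
  \<open>Li\<close> for \<open>s, ...\<close> divided by the variable.\<close>

lemma diffs_mpl_coeff_Suc:
  "diffs (\<lambda>n. complex_of_real (mpl_coeff (Suc s # ss) n)) = (\<lambda>n. of_real (mpl_coeff (s # ss) (Suc n)))"
  by (simp add: diffs_def fun_eq_iff del: of_nat_Suc)

text \<open>Corresponds to the derivative of \<open>Li\<close> for \<open>1, ss\<close> being
  \<open>Li\<close> for \<open>ss\<close> divided by \<open>1 - z\<close>.\<close>

lemma diffs_mpl_coeff_one:
  "diffs (\<lambda>n. complex_of_real (mpl_coeff (1 # ss) n)) = (\<lambda>n. \<Sum>m\<le>n. of_real (mpl_coeff ss m))"
  by (simp add: diffs_def fun_eq_iff lessThan_Suc_atMost del: of_nat_Suc sum.lessThan_Suc)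

text \<open>Outer induction on the list, inner induction on the first exponent. Exponent
  \<open>1\<close> comes from the shorter list by partial sums, each larger exponent from its
  predecessor by a shift, and both are followed by an antiderivative.\<close>

lemma continues_to_cut_plane_mpl_coeff:
  assumes "\<forall>s\<in>set ss. s \<ge> 1"
  shows "continues_to_cut_plane (\<lambda>n. of_real (mpl_coeff ss n))"
  using assms
proof (induction ss)
  case Nil
  have "(\<lambda>n. of_real (mpl_coeff [] n) * z ^ n) sums 1" for z :: complex
    using sums_finite[of "{0}" "\<lambda>n. of_real (mpl_coeff [] n) * z ^ n"] by simp
  then show ?case
    unfolding continues_to_cut_plane_def by (intro exI[of _ "\<lambda>_. 1"]) auto
next
  case (Cons s ss)
  have "s \<ge> 1" using Cons.prems by simp
  then show ?case
  proof (induction s rule: dec_induct)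
    case base
    show ?case
    proof (rule continues_to_cut_plane_antideriv)
      show "continues_to_cut_plane (diffs (\<lambda>n. complex_of_real (mpl_coeff (1 # ss) n)))"
        unfolding diffs_mpl_coeff_one
        using Cons by (intro continues_to_cut_plane_partial_sums summable_mpl_coeff) auto
      show "summable (\<lambda>n. of_real (mpl_coeff (1 # ss) n) * z ^ n)" if "norm z < 1" for z :: complex
        using Cons.prems that by (intro summable_norm_cancel[OF summable_mpl_coeff]) auto
    qed
  next
    case (step s)
    show ?case
    proof (rule continues_to_cut_plane_antideriv)
      show "continues_to_cut_plane (diffs (\<lambda>n. complex_of_real (mpl_coeff (Suc s # ss) n)))"
        unfolding diffs_mpl_coeff_Suc by (rule continues_to_cut_plane_shift[OF step.IH]) simp
      show "summable (\<lambda>n. of_real (mpl_coeff (Suc s # ss) n) * z ^ n)" if "norm z < 1" for z :: complex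
        using Cons.prems that by (intro summable_norm_cancel[OF summable_mpl_coeff]) auto
    qed
  qed
qed

text \<open>The continuation just constructed is a witness for the choice in the definition of
  \<open>Li\<close>.\<close>

lemma Li_holomorphic:
  assumes "ss \<noteq> []" and "\<forall>s\<in>set ss. s \<ge> 1"
  shows "Li ss holomorphic_on cut_plane" and "norm z < 1 \<Longrightarrow> Li ss z = Li_series ss z"
proof -
  obtain f where f: "f holomorphic_on cut_plane"
    and f_sums: "\<And>z. norm z < 1 \<Longrightarrow> (\<lambda>n. of_real (mpl_coeff ss n) * z ^ n) sums f z"
    using continues_to_cut_plane_mpl_coeff[OF assms(2)] by (auto simp: continues_to_cut_plane_def)
  have "f z = Li_series ss z" if "norm z < 1" for z
    by (rule sums_unique2[OF f_sums[OF that] Li_series_sums[OF assms that]])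
  with f have "\<exists>f. f holomorphic_on cut_plane \<and> (\<forall>z\<in>ball 0 1. f z = Li_series ss z)"
    by (intro exI[of _ f]) simp
  from someI_ex[OF this] show "Li ss holomorphic_on cut_plane" "norm z < 1 \<Longrightarrow> Li ss z = Li_series ss z"
    by (auto simp: Li_def)
qed

subsection \<open>Analytic continuation of the identity\<close>

text \<open>Weierstrass M-test on closed discs. The majorants also give absolute convergence, which
  identifies the ordered series with the unordered one in \<open>tail_sum\<close>.\<close>

lemma holomorphic_tail_sum:
  assumes F: "\<And>n. (\<lambda>z. F z n) holomorphic_on ball 0 1" and a: "a holomorphic_on ball 0 1"
    and M: "\<And>r. 0 \<le> r \<Longrightarrow> r < 1 \<Longrightarrow> \<exists>M. summable M \<and>
      (\<forall>k. \<forall>z\<in>cball 0 r. norm (a z ^ Suc k / of_nat (Suc (n + k)) * F z (Suc (n + k))) \<le> M k)"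
  shows "(\<lambda>z. tail_sum (a z) (F z) n) holomorphic_on ball 0 1"
proof -
  define t where "t k z = a z ^ Suc k / of_nat (Suc (n + k)) * F z (Suc (n + k))" for k z
  have t: "t k holomorphic_on ball 0 1" for k
    unfolding t_def using F a by (intro holomorphic_intros) (auto simp del: of_nat_Suc)
  have "(\<lambda>z. \<Sum>k. t k z) holomorphic_on ball 0 1"
  proof (rule holomorphic_uniform_sequence[OF open_ball])
    show "(\<lambda>z. \<Sum>k<m. t k z) holomorphic_on ball 0 1" for m
      using t by (intro holomorphic_intros)
    fix x :: complex assume x: "x \<in> ball 0 1"
    \<comment> \<open>Half the distance from \<open>x\<close> to the unit circle, so that
      \<open>norm x + d < 1\<close>.\<close>
    define d where "d = (1 - norm x) / 2"
    have sub: "cball x d \<subseteq> cball 0 (norm x + d)"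
      by (rule cball_subset_cball_iff[THEN iffD2]) (simp add: dist_norm)
    also have "\<dots> \<subseteq> ball 0 1"
      using x by (auto simp: d_def field_simps)
    finally have sub': "cball x d \<subseteq> ball 0 1" .
    obtain M where M: "summable M" "\<And>k z. z \<in> cball 0 (norm x + d) \<Longrightarrow> norm (t k z) \<le> M k"
      using M[of "norm x + d"] x unfolding t_def by (auto simp: d_def field_simps)
    have "uniform_limit (cball x d) (\<lambda>m z. \<Sum>k<m. t k z) (\<lambda>z. \<Sum>k. t k z) sequentially"
      using M sub by (intro Weierstrass_m_test[of _ _ M]) auto
    then show "\<exists>d>0. cball x d \<subseteq> ball 0 1 \<and> uniform_limit (cball x d) (\<lambda>m z. \<Sum>k<m. t k z) (\<lambda>z. \<Sum>k. t k z) sequentially"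
      using x sub' by (intro exI[of _ d]) (auto simp: d_def)
  qed
  moreover have "(\<Sum>k. t k z) = tail_sum (a z) (F z) n" if z: "z \<in> ball 0 1" for z
  proof -
    obtain M where M: "summable M" "\<And>k. norm (t k z) \<le> M k"
      using M[of "norm z"] z unfolding t_def by auto
    then have summable: "summable (\<lambda>k. norm (t k z))"
      using summable_comparison_test'[of M 0 "\<lambda>k. norm (t k z)"] by simp
    have "((\<lambda>k. t k z) has_sum (\<Sum>k. t k z)) UNIV"
      by (rule norm_summable_imp_has_sum[OF summable summable_sums[OF summable_norm_cancel[OF summable]]])
    then show ?thesis unfolding tail_sum_def t_def by (rule infsumI[symmetric])
  qed
  ultimately show ?thesis
    by (rule holomorphic_transform)
qed

text \<open>Arguments are passed as functions of \<open>z\<close> so that they may vary with it. The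
  majorant is geometric for the first argument and telescoping for all later ones.\<close>

lemma holomorphic_fold_tail_sum:
  assumes "\<And>h. h \<in> set hs \<Longrightarrow> h holomorphic_on ball 0 1"
    and "\<And>h z. h \<in> set hs \<Longrightarrow> norm z < 1 \<Longrightarrow> norm (h z) \<le> 1"
  shows "(\<lambda>z. fold tail_sum (z # map (\<lambda>h. h z) hs) (\<lambda>_. 1) n) holomorphic_on ball 0 1"
  using assms
proof (induction hs arbitrary: n rule: rev_induct)
  case Nil
  have "(\<lambda>z. tail_sum z (\<lambda>_. 1) n) holomorphic_on ball 0 1"
  proof (rule holomorphic_tail_sum)
    fix r :: real assume r: "0 \<le> r" "r < 1"
    have "norm (z ^ Suc k / of_nat (Suc (n + k)) * 1) \<le> r ^ Suc k" if "z \<in> cball 0 r" for z :: complex and k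
    proof -
      have "norm z ^ Suc k / real (Suc (n + k)) \<le> norm z ^ Suc k"
        by (simp add: divide_le_eq mult_le_cancel_left1 del: power_Suc)
      also have "\<dots> \<le> r ^ Suc k" using that by (intro power_mono) auto
      finally show ?thesis by (simp add: norm_divide norm_power norm_mult del: of_nat_Suc)
    qed
    moreover have "summable (\<lambda>k. r ^ Suc k)"
      using r by (subst summable_Suc_iff) (simp add: summable_geometric)
    ultimately show "\<exists>M. summable M \<and>
      (\<forall>k. \<forall>z\<in>cball 0 r. norm ((z :: complex) ^ Suc k / of_nat (Suc (n + k)) * 1) \<le> M k)"
      by (intro exI[of _ "\<lambda>k. r ^ Suc k"] conjI allI ballI)
  qed (auto intro: holomorphic_intros)
  then show ?case by simp
next
  case (snoc h hs)
  have "(\<lambda>z. tail_sum (h z) (fold tail_sum (z # map (\<lambda>h. h z) hs) (\<lambda>_. 1)) n) holomorphic_on ball 0 1"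
  proof (rule holomorphic_tail_sum)
    show "(\<lambda>z. fold tail_sum (z # map (\<lambda>h. h z) hs) (\<lambda>_. 1) m) holomorphic_on ball 0 1" for m
      using snoc by auto
    show "h holomorphic_on ball 0 1" using snoc.prems by auto
    fix r :: real assume r: "0 \<le> r" "r < 1"
    define K where "K = r / (1 - r)"
    let ?M = "\<lambda>k. K * (1 / (real (Suc (n + k)) * real (Suc (Suc (n + k)))))"
    have "norm (h z ^ Suc k / of_nat (Suc (n + k)) * fold tail_sum (z # map (\<lambda>h. h z) hs) (\<lambda>_. 1) (Suc (n + k)))
        \<le> ?M k" if z: "z \<in> cball 0 r" for z k
    proof -
      have zr: "norm z \<le> r" "norm z < 1" using z r by auto
      have "norm (h z) ^ Suc k \<le> 1"
        using snoc.prems(2)[of h z] zr by (intro power_le_one) auto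
      then have 1: "norm (h z ^ Suc k / of_nat (Suc (n + k))) \<le> 1 / real (Suc (n + k))"
        by (simp add: norm_divide norm_power divide_right_mono norm_mult del: of_nat_Suc)
      have "norm (fold tail_sum (z # map (\<lambda>h. h z) hs) (\<lambda>_. 1) (Suc (n + k)))
          \<le> norm z / (1 - norm z) / real (Suc (Suc (n + k)))"
        using zr snoc.prems(2) by (intro norm_fold_tail_sum_le) auto
      also have "\<dots> \<le> K / real (Suc (Suc (n + k)))"
        unfolding K_def using zr r by (intro divide_right_mono frac_le) auto
      finally have "norm (fold tail_sum (z # map (\<lambda>h. h z) hs) (\<lambda>_. 1) (Suc (n + k))) \<le> K / real (Suc (Suc (n + k)))" .
      from mult_mono[OF 1 this] show ?thesis
        by (simp add: norm_mult norm_divide norm_power del: of_nat_Suc power_Suc fold.simps)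
    qed
    moreover have "summable ?M"
      by (intro summable_mult summable_on_imp_summable has_sum_imp_summable[OF has_sum_telescoping])
    ultimately show "\<exists>M. summable M \<and> (\<forall>k. \<forall>z\<in>cball 0 r.
        norm (h z ^ Suc k / of_nat (Suc (n + k)) * fold tail_sum (z # map (\<lambda>h. h z) hs) (\<lambda>_. 1) (Suc (n + k))) \<le> M k)"
      by (intro exI[of _ ?M] conjI allI ballI)
  qed
  then show ?case by simp
qed

lemma mu_args_eq_map:
  assumes "ss \<noteq> []"
  obtains hs where "\<And>z. mu_args z ss = z # map (\<lambda>h. h z) hs"
    and "\<And>h. h \<in> set hs \<Longrightarrow> h = (\<lambda>z. z) \<or> h = (\<lambda>_. 1)"
proof -
  obtain s ss' where ss: "rev ss = s # ss'"
    using assms by (cases "rev ss") auto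
  show ?thesis
  proof
    show "mu_args z ss = z # map (\<lambda>h. h z)
        (replicate (s - 1) (\<lambda>_. 1) @ concat (map (\<lambda>s. (\<lambda>z. z) # replicate (s - 1) (\<lambda>_. 1)) ss'))" for z
      by (simp add: mu_args_def ss map_concat o_def)
  qed (auto split: if_splits)
qed

text \<open>If the image were a real \<open>t \<ge> 1\<close>, then \<open>z * (t - 1) = t\<close>,
  and hence \<open>t = norm z * (t - 1) \<le> t - 1\<close>.\<close>

lemma Landen_map_in_cut_plane:
  assumes "norm z < 1"
  shows "- z / (1 - z) \<in> cut_plane"
proof (rule ccontr)
  assume "- z / (1 - z) \<notin> cut_plane"
  then obtain t where t: "t \<ge> 1" "- z / (1 - z) = of_real t"
    by (auto simp: cut_plane_def)
  have "z \<noteq> 1" using assms by auto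
  with t(2) have *: "z * of_real (t - 1) = of_real t"
    by (simp add: divide_simps algebra_simps split: if_splits)
  then have "norm z * \<bar>t - 1\<bar> = \<bar>t\<bar>"
    by (metis norm_mult norm_of_real)
  moreover have "norm z * (t - 1) \<le> t - 1"
    using assms t(1) by (intro mult_left_le_one_le) auto
  ultimately show False using t(1) by simp
qed

text \<open>For \<open>norm z < 1 / 3\<close> the point \<open>z\<close> is closer to
  \<open>0\<close> than to \<open>1\<close>, so \<open>norm w < 1\<close>; then the transport
  applies and \<open>Li\<close> at \<open>w\<close> is given by its series. Evaluating the connected
  sum at \<open>0\<close> gives that series up to sign.\<close>

lemma Li_Landen_small:
  assumes ss: "ss \<noteq> []" "\<forall>s\<in>set ss. s \<ge> 1" and z: "norm z < 1 / 3"
  shows "Li ss (- z / (1 - z)) = (-1) ^ length ss * fold tail_sum (mu_args z ss) (\<lambda>_. 1) 0"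
proof -
  define w where "w = - z / (1 - z)"
  have "1 - norm z \<le> norm (1 - z)"
    using norm_triangle_ineq2[of 1 z] by simp
  with z have "norm z < norm (1 - z)" by linarith
  then have w: "norm w < 1"
    by (simp add: w_def norm_divide divide_less_eq)
  have "fold tail_sum (mu_args z ss) (\<lambda>_. 1) 0
      = (\<Sum>\<^sub>\<infinity>m. (-1) ^ length ss * (w ^ m * of_real (mpl_coeff ss m)))"
    using fold_tail_sum_mu_args[OF ss(2) _ w w_def] z by (simp add: connected_sum_def)
  also have "\<dots> = (-1) ^ length ss * Li ss w"
    by (simp add: infsum_cmult_right' Li_holomorphic(2)[OF ss w] Li_series_eq_power_series[OF ss w])
  finally have "(-1) ^ length ss * fold tail_sum (mu_args z ss) (\<lambda>_. 1) 0
      = ((-1) ^ length ss * (-1) ^ length ss) * Li ss w" by simp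
  also have "(-1) ^ length ss * (-1) ^ length ss = (1 :: complex)"
    by (simp flip: power_mult_distrib)
  finally show ?thesis by (simp add: w_def)
qed

lemma mu_mu_args:
  assumes "ss \<noteq> []" and z: "norm z < 1"
  shows "mu_converges (mu_args z ss) \<and> mu (mu_args z ss) = fold tail_sum (mu_args z ss) (\<lambda>_. 1) 0"
proof -
  obtain hs where hs: "\<And>z. mu_args z ss = z # map (\<lambda>h. h z) hs"
      and hs': "\<And>h. h \<in> set hs \<Longrightarrow> h = (\<lambda>z. z) \<or> h = (\<lambda>_. 1)"
    using mu_args_eq_map[OF assms(1)] by metis
  have "norm b \<le> 1" if "b \<in> set (map (\<lambda>h. h z) hs)" for b
    using that hs' z by fastforce
  then show ?thesis
    unfolding hs using mu_eq_fold_tail_sum[OF z] by blast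
qed

lemma holomorphic_fold_tail_sum_mu_args:
  assumes "ss \<noteq> []"
  shows "(\<lambda>z. fold tail_sum (mu_args z ss) (\<lambda>_. 1) n) holomorphic_on ball 0 1"
proof -
  obtain hs where hs: "\<And>z. mu_args z ss = z # map (\<lambda>h. h z) hs"
      and hs': "\<And>h. h \<in> set hs \<Longrightarrow> h = (\<lambda>z. z) \<or> h = (\<lambda>_. 1)"
    using mu_args_eq_map[OF assms(1)] by metis
  show ?thesis
    unfolding hs
  proof (rule holomorphic_fold_tail_sum)
    show "h holomorphic_on ball 0 1" if "h \<in> set hs" for h
      using hs'[OF that] by (auto intro: holomorphic_intros)
    show "norm (h z) \<le> 1" if "h \<in> set hs" "norm z < 1" for h z
      using hs'[OF that(1)] that(2) by auto
  qed
qed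

lemma holomorphic_Li_Landen:
  assumes "ss \<noteq> []" and "\<forall>s\<in>set ss. s \<ge> 1"
  shows "(\<lambda>z. Li ss (- z / (1 - z))) holomorphic_on ball 0 1"
proof -
  have "(\<lambda>z. - z / (1 - z)) holomorphic_on ball 0 1"
    by (intro holomorphic_intros) auto
  moreover have "(\<lambda>z. - z / (1 - z)) ` ball 0 1 \<subseteq> cut_plane"
    using Landen_map_in_cut_plane by auto
  ultimately have "(Li ss \<circ> (\<lambda>z. - z / (1 - z))) holomorphic_on ball 0 1"
    using Li_holomorphic(1)[OF assms] by (intro holomorphic_on_compose_gen)
  then show ?thesis by (simp add: o_def)
qed

text \<open>Identity theorem on the connected unit disc, starting from agreement on the disc of
  radius \<open>1 / 3\<close>.\<close>

lemma Li_Landen: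
  assumes ss: "ss \<noteq> []" "\<forall>s\<in>set ss. s \<ge> 1" and z: "norm z < 1"
  shows "Li ss (- z / (1 - z)) = (-1) ^ length ss * fold tail_sum (mu_args z ss) (\<lambda>_. 1) 0"
proof (rule analytic_continuation_open[of "ball 0 (1 / 3)" "ball 0 1" "\<lambda>z. Li ss (- z / (1 - z))"
      "\<lambda>z. (-1) ^ length ss * fold tail_sum (mu_args z ss) (\<lambda>_. 1) 0"])
  show "(\<lambda>z. Li ss (- z / (1 - z))) holomorphic_on ball 0 1"
    using ss by (rule holomorphic_Li_Landen)
  show "(\<lambda>z. (-1) ^ length ss * fold tail_sum (mu_args z ss) (\<lambda>_. 1) 0) holomorphic_on ball 0 1"
    by (intro holomorphic_on_mult holomorphic_on_const holomorphic_fold_tail_sum_mu_args ss(1))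
  show "Li ss (- z / (1 - z)) = (-1) ^ length ss * fold tail_sum (mu_args z ss) (\<lambda>_. 1) 0"
    if "z \<in> ball 0 (1 / 3)" for z
    using that Li_Landen_small[OF ss] by simp
  show "ball 0 (1 / 3) \<subseteq> ball (0 :: complex) 1"
    by (rule subset_ball) simp
  show "z \<in> ball 0 1" using z by simp
qed simp_all

theorem theorem7:
  fixes ss :: "nat list" and z :: complex
  assumes "ss \<noteq> []" and "\<forall>s\<in>set ss. s \<ge> 1" and "norm z < 1"
  shows "mu_converges (mu_args z ss) \<and>
         Li ss (- z / (1 - z)) = (-1) ^ length ss * mu (mu_args z ss)"
  using mu_mu_args[OF assms(1,3)] Li_Landen[OF assms] by simp

end
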